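(* Let $n$ be a positive integer. Let $L= \{\frac{a_1}{b_1}, \ldots , \frac{a_s}{b_s}\}$, where for every $i \in [s]$, $\frac{a_i}{b_i} \in [0,1)$ is an irreducible fraction, and let $\frac{a}{b} = \max(\frac{a_1}{b_1}, \ldots , \frac{a_s}{b_s})$. Let $\alpha = \max(\frac{1}{2}, \frac{4a - b}{2b})$. Let $\mathcal{F}$ be a fractional $L$-intersecting family of subsets of $[n]$ such that $|A| > \alpha n$ for every $A \in \mathcal{F}$. Then $|\mathcal{F}| \leq n$.
   Context: $[n]=\{1,\ldots,n\}$. A family $\mathcal{F}=\{A_1,\ldots,A_m\}$ of (distinct) subsets of $[n]$ is a fractional $L$-intersecting family if for every distinct $i,j\in[m]$ there exists $\frac{a}{b}\in L$ such that $|A_i\cap A_j|\in\{\frac{a}{b}|A_i|,\frac{a}{b}|A_j|\}$. *)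

theory Defs
  imports Complex_Main
begin

text \<open>A family is a set of sets, so its members are pairwise distinct by construction.\<close>

definition fractional_intersecting :: "nat \<Rightarrow> real set \<Rightarrow> nat set set \<Rightarrow> bool" where
  "fractional_intersecting n L F \<longleftrightarrow>
     F \<subseteq> Pow {1..n} \<and>
     (\<forall>A\<in>F. \<forall>B\<in>F. A \<noteq> B \<longrightarrow>
       (\<exists>r\<in>L. real (card (A \<inter> B)) \<in> {r * real (card A), r * real (card B)}))"

end

theory Submission
  imports Defs
begin

text \<open>
  Encode each set by its sign vector in \<open>{1, -1}\<^sup>n\<close>. Two distinct members \<open>A\<close>, \<open>B\<close> have inner product
  \<open>n - 2 |A| - 2 |B| + 4 |A \<inter> B|\<close>, which the size condition makes negative, and every
  sign vector has positive inner product with the all-one vector because \<open>|A| > n / 2\<close>. Vectors in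
  an open half space with pairwise nonpositive inner products are linearly independent, so there
  are at most \<open>n\<close> of them.
\<close>

text \<open>Gaussian elimination, one coordinate \<open>j\<close> at a time: either all vectors
  vanish at \<open>j\<close>, or a pivot \<open>x0\<close> clears that coordinate from the others,
  and the induction hypothesis gives a relation among the reduced vectors.\<close>

lemma nontrivial_linear_relation:
  fixes v :: "'a \<Rightarrow> 'b \<Rightarrow> 'c::field"
  assumes "finite J" "finite S" "card J < card S"
  shows "\<exists>c. (\<exists>x\<in>S. c x \<noteq> 0) \<and> (\<forall>j\<in>J. (\<Sum>x\<in>S. c x * v x j) = 0)"
  using assms
proof (induction J arbitrary: S v rule: finite_induct)
  case empty
  then obtain x where "x \<in> S" by fastforce
  then show ?case by (intro exI[of _ "\<lambda>_. 1"]) auto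
next
  case (insert j J)
  show ?case
  proof (cases "\<forall>x\<in>S. v x j = 0")
    case True
    have "card J < card S" using insert by simp
    from insert.IH[OF insert.prems(1) this, of v] True show ?thesis by auto
  next
    case False
    then obtain x0 where x0: "x0 \<in> S" "v x0 j \<noteq> 0" by blast
    define T where "T = S - {x0}"
    have T: "finite T" "card J < card T" "S = insert x0 T" "x0 \<notin> T"
      using insert x0 by (auto simp: T_def)
    obtain c where c: "\<exists>x\<in>T. c x \<noteq> 0"
      "\<And>i. i \<in> J \<Longrightarrow> (\<Sum>x\<in>T. c x * (v x i - v x j / v x0 j * v x0 i)) = 0"
      using insert.IH[OF T(1,2), of "\<lambda>x i. v x i - v x j / v x0 j * v x0 i"] by blast
    \<comment> \<open>The value \<open>k\<close> makes coordinate \<open>j\<close> of the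
      combination vanish. It is also the total multiple of \<open>v x0\<close> subtracted from the
      reduced vectors, so their relation lifts to the original ones.\<close>
    define k where "k = - (\<Sum>x\<in>T. c x * v x j) / v x0 j"
    define d where "d = c(x0 := k)"
    have expand: "(\<Sum>x\<in>S. d x * v x i) = k * v x0 i + (\<Sum>x\<in>T. c x * v x i)" for i
    proof -
      have "(\<Sum>x\<in>T. d x * v x i) = (\<Sum>x\<in>T. c x * v x i)"
        using T(4) by (intro sum.cong) (auto simp: d_def)
      then show ?thesis using T by (simp add: d_def)
    qed
    have "(\<Sum>x\<in>S. d x * v x i) = 0" if "i \<in> insert j J" for i
    proof (cases "i = j")
      case True
      then show ?thesis using x0 by (simp add: expand k_def)
    next
      case False
      with that have "i \<in> J" by simp
      have "(\<Sum>x\<in>T. c x * (v x i - v x j / v x0 j * v x0 i))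
          = (\<Sum>x\<in>T. c x * v x i) - (\<Sum>x\<in>T. c x * v x j * (v x0 i / v x0 j))"
        unfolding sum_subtractf[symmetric] by (intro sum.cong) (auto simp: algebra_simps)
      also have "\<dots> = (\<Sum>x\<in>T. c x * v x i) + k * v x0 i"
        by (simp add: k_def sum_distrib_right sum_divide_distrib)
      finally show ?thesis using c(2)[OF \<open>i \<in> J\<close>] by (simp add: expand add.commute)
    qed
    moreover have "\<exists>x\<in>S. d x \<noteq> 0" using c(1) T(3,4) by (auto simp: d_def)
    ultimately show ?thesis by blast
  qed
qed

text \<open>Expresses the squared norm of a combination through the Gram matrix, so that two choices
  of coefficients can be compared entry by entry.\<close>

lemma sum_square_linear_combination:
  fixes v :: "'a \<Rightarrow> 'b \<Rightarrow> 'c::comm_semiring_1"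
  shows "(\<Sum>j\<in>J. (\<Sum>x\<in>S. c x * v x j)\<^sup>2)
       = (\<Sum>x\<in>S. \<Sum>y\<in>S. c x * c y * (\<Sum>j\<in>J. v x j * v y j))"
proof -
  have "(\<Sum>j\<in>J. (\<Sum>x\<in>S. c x * v x j)\<^sup>2)
      = (\<Sum>j\<in>J. \<Sum>x\<in>S. \<Sum>y\<in>S. c x * c y * (v x j * v y j))"
    by (simp add: power2_eq_square sum_product mult_ac)
  also have "\<dots> = (\<Sum>x\<in>S. \<Sum>j\<in>J. \<Sum>y\<in>S. c x * c y * (v x j * v y j))"
    by (rule sum.swap)
  also have "\<dots> = (\<Sum>x\<in>S. \<Sum>y\<in>S. \<Sum>j\<in>J. c x * c y * (v x j * v y j))"
    by (intro sum.cong refl sum.swap)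
  finally show ?thesis by (simp add: sum_distrib_left)
qed

text \<open>More vectors than coordinates would satisfy a nontrivial relation. Obtuseness turns it
  into one with nonnegative coefficients, which the half space forbids.\<close>

lemma card_obtuse_half_space_le:
  fixes v :: "'a \<Rightarrow> 'b \<Rightarrow> real"
  assumes "finite J" "finite S"
    and obtuse: "\<And>x y. x \<in> S \<Longrightarrow> y \<in> S \<Longrightarrow> x \<noteq> y \<Longrightarrow> (\<Sum>j\<in>J. v x j * v y j) \<le> 0"
    and half_space: "\<And>x. x \<in> S \<Longrightarrow> (\<Sum>j\<in>J. v x j * w j) > 0"
  shows "card S \<le> card J"
proof (rule ccontr)
  assume "\<not> card S \<le> card J"
  then obtain c where nz: "\<exists>x\<in>S. c x \<noteq> 0"
    and rel: "\<And>j. j \<in> J \<Longrightarrow> (\<Sum>x\<in>S. c x * v x j) = 0"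
    using nontrivial_linear_relation[OF assms(1,2), of v] by force
  \<comment> \<open>Replacing the coefficients by their absolute values cannot increase the norm.\<close>
  have "(\<Sum>j\<in>J. (\<Sum>x\<in>S. \<bar>c x\<bar> * v x j)\<^sup>2) \<le> (\<Sum>j\<in>J. (\<Sum>x\<in>S. c x * v x j)\<^sup>2)"
    unfolding sum_square_linear_combination
  proof (intro sum_mono)
    fix x y assume xy: "x \<in> S" "y \<in> S"
    have "c x * c y \<le> \<bar>c x\<bar> * \<bar>c y\<bar>" by (metis abs_ge_self abs_mult)
    \<comment> \<open>On the diagonal the two coefficients agree; off it the larger coefficient
      multiplies a nonpositive inner product.\<close>
    then show "\<bar>c x\<bar> * \<bar>c y\<bar> * (\<Sum>j\<in>J. v x j * v y j) \<le> c x * c y * (\<Sum>j\<in>J. v x j * v y j)"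
      using obtuse[OF xy] by (cases "x = y") (auto intro: mult_right_mono_neg)
  qed
  also have "\<dots> = 0" using rel by simp
  finally have "(\<Sum>j\<in>J. (\<Sum>x\<in>S. \<bar>c x\<bar> * v x j)\<^sup>2) = 0"
    by (simp add: order_antisym sum_nonneg)
  then have abs_rel: "(\<Sum>x\<in>S. \<bar>c x\<bar> * v x j) = 0" if "j \<in> J" for j
    using that \<open>finite J\<close> by (simp add: sum_nonneg_eq_0_iff)
  \<comment> \<open>Pairing the nonnegative relation with \<open>w\<close> gives a vanishing sum of
    nonnegative terms, so each coefficient must be zero.\<close>
  have "(\<Sum>x\<in>S. \<bar>c x\<bar> * (\<Sum>j\<in>J. v x j * w j)) = (\<Sum>j\<in>J. (\<Sum>x\<in>S. \<bar>c x\<bar> * v x j) * w j)"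
    by (simp add: sum_distrib_left sum_distrib_right mult.assoc) (rule sum.swap)
  also have "\<dots> = 0" using abs_rel by simp
  finally have "\<forall>x\<in>S. \<bar>c x\<bar> * (\<Sum>j\<in>J. v x j * w j) = 0"
    using \<open>finite S\<close> half_space by (subst (asm) sum_nonneg_eq_0_iff) (auto simp: less_imp_le)
  then show False using nz half_space by force
qed

definition sign_vector :: "'a set \<Rightarrow> 'a \<Rightarrow> real" where
  "sign_vector A j = (if j \<in> A then 1 else - 1)"

lemma sum_sign_vector:
  assumes "finite J" "A \<subseteq> J"
  shows "(\<Sum>j\<in>J. sign_vector A j) = 2 * real (card A) - real (card J)"
proof -
  have "(\<Sum>j\<in>J. sign_vector A j) = (\<Sum>j\<in>J. 2 * of_bool (j \<in> A) - 1)"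
    by (intro sum.cong) (auto simp: sign_vector_def)
  also have "\<dots> = 2 * real (card (J \<inter> A)) - real (card J)"
    using assms(1) by (simp add: sum_subtractf sum_distrib_left[symmetric])
  finally show ?thesis using assms(2) by (simp add: Int_absorb1)
qed

text \<open>The product of two signs is affine in the signs of \<open>A\<close>, \<open>B\<close>
  and \<open>A \<inter> B\<close>, which reduces the claim to
  \<open>sum_sign_vector\<close>.\<close>

lemma inner_sign_vector:
  assumes "finite J" "A \<subseteq> J" "B \<subseteq> J"
  shows "(\<Sum>j\<in>J. sign_vector A j * sign_vector B j)
       = real (card J) - 2 * real (card A) - 2 * real (card B) + 4 * real (card (A \<inter> B))"
proof -
  have "(\<Sum>j\<in>J. sign_vector A j * sign_vector B j)
      = (\<Sum>j\<in>J. 2 * sign_vector (A \<inter> B) j - sign_vector A j - sign_vector B j + 1)"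
    by (intro sum.cong) (auto simp: sign_vector_def)
  also have "\<dots> = 2 * (\<Sum>j\<in>J. sign_vector (A \<inter> B) j) - (\<Sum>j\<in>J. sign_vector A j)
      - (\<Sum>j\<in>J. sign_vector B j) + real (card J)"
    by (simp add: sum.distrib sum_subtractf sum_distrib_left)
  also have "(\<Sum>j\<in>J. sign_vector (A \<inter> B) j) = 2 * real (card (A \<inter> B)) - real (card J)"
    using assms by (intro sum_sign_vector) auto
  finally show ?thesis using assms by (simp add: sum_sign_vector)
qed

text \<open>Here \<open>x\<close> is the size of the set of which the intersection is the fraction
  \<open>r\<close>, \<open>y\<close> the size of the other set, and \<open>t\<close> the maximum of
  \<open>L\<close>. For \<open>r \<le> 1/2\<close> the terms in \<open>x\<close> contribute at most
  0. Otherwise they contribute at most \<open>(4 * t - 2) * m\<close>, which explains the second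
  bound on \<open>y\<close>.\<close>

lemma fractional_intersection_inner_neg:
  fixes x y r t m :: real
  assumes "0 \<le> x" "x \<le> m" "r \<le> t" "y > m / 2" "y > (4 * t - 1) / 2 * m"
  shows "m - 2 * x - 2 * y + 4 * (r * x) < 0"
proof (cases "r \<le> 1/2")
  case True
  then have "r * x \<le> 1/2 * x" using assms(1) by (rule mult_right_mono)
  then show ?thesis using assms(4) by linarith
next
  case False
  then have "(4 * r - 2) * x \<le> (4 * t - 2) * m" using assms by (intro mult_mono) auto
  then show ?thesis using assms(5) by (simp add: algebra_simps)
qed

theorem theorem3:
  fixes n s :: nat and a b :: "nat \<Rightarrow> nat" and p q :: nat
    and L :: "real set" and \<alpha> :: real and F :: "nat set set"
  assumes "n \<ge> 1" and "s \<ge> 1"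
    and "\<And>i. i \<in> {1..s} \<Longrightarrow> b i > 0 \<and> coprime (a i) (b i) \<and> real (a i) / real (b i) \<in> {0..<1}"
    and "L = (\<lambda>i. real (a i) / real (b i)) ` {1..s}"
    and "q > 0" and "coprime p q" and "real p / real q = Max L"
    and "\<alpha> = max (1/2) ((4 * real p - real q) / (2 * real q))"
    and "fractional_intersecting n L F"
    and "\<And>A. A \<in> F \<Longrightarrow> real (card A) > \<alpha> * real n"
  shows "card F \<le> n"
proof -
  have \<alpha>: "\<alpha> = max (1/2) ((4 * Max L - 1) / 2)"
    unfolding assms(8) assms(7)[symmetric] using \<open>q > 0\<close> by (simp add: field_simps)
  have F: "F \<subseteq> Pow {1..n}"
    and L: "\<And>A B. A \<in> F \<Longrightarrow> B \<in> F \<Longrightarrow> A \<noteq> B \<Longrightarrow>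
      \<exists>r\<in>L. real (card (A \<inter> B)) \<in> {r * real (card A), r * real (card B)}"
    using assms(9) unfolding fractional_intersecting_def by blast+
  have card_le: "card A \<le> n" if "A \<in> F" for A
    using F that card_mono[of "{1..n}" A] by auto
  have large: "real (card A) > real n / 2" "real (card A) > (4 * Max L - 1) / 2 * real n"
    if "A \<in> F" for A
  proof -
    have "1/2 * real n \<le> \<alpha> * real n" "(4 * Max L - 1) / 2 * real n \<le> \<alpha> * real n"
      unfolding \<alpha> by (intro mult_right_mono; simp)+
    then show "real (card A) > real n / 2" "real (card A) > (4 * Max L - 1) / 2 * real n"
      using assms(10)[OF that] by linarith+
  qed
  have "card F \<le> card {1..n}"
  proof (rule card_obtuse_half_space_le[where v = sign_vector and w = "\<lambda>_. 1"])
    show "finite F" using F by (rule finite_subset) simp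
  next
    fix A B assume AB: "A \<in> F" "B \<in> F" "A \<noteq> B"
    have sub: "A \<subseteq> {1..n}" "B \<subseteq> {1..n}" using AB F by auto
    obtain r where r: "r \<in> L"
      "real (card (A \<inter> B)) = r * real (card A) \<or> real (card (A \<inter> B)) = r * real (card B)"
      using L[OF AB] by auto
    have "r \<le> Max L" using r(1) by (intro Max_ge) (simp_all add: assms(4))
    \<comment> \<open>The intersection may be a fraction of either set, so the bound is needed with
      both assignments of \<open>x\<close> and \<open>y\<close>.\<close>
    then have "real n - 2 * real (card A) - 2 * real (card B) + 4 * (r * real (card A)) < 0"
      "real n - 2 * real (card B) - 2 * real (card A) + 4 * (r * real (card B)) < 0"
      using AB card_le large by (auto intro!: fractional_intersection_inner_neg)
    then show "(\<Sum>j\<in>{1..n}. sign_vector A j * sign_vector B j) \<le> 0"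
      unfolding inner_sign_vector[OF finite_atLeastAtMost sub] using r(2) by auto
  next
    fix A assume "A \<in> F"
    then show "(\<Sum>j\<in>{1..n}. sign_vector A j * 1) > 0"
      using F large(1)[of A] sum_sign_vector[of "{1..n}" A] by auto
  qed simp
  then show ?thesis by simp
qed

end
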